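(* Let $q$ be a prime power, let $d\ge 5$, $r\ge 1$ and $m\ge 1$ be integers, and let $A_1,\dots,A_m\subseteq\mathbb{F}_q$ be subsets with $|A_i|=r+1$ for all $i$. Let $H$ be the associated $(m+d-2)\times m(r+1)$ Vandermonde-type matrix over $\mathbb{F}_q$ defined in the context, and put $t=\lfloor\frac{d-1}{2}\rfloor$. Then any $d-1$ columns of $H$ (that is, every set of at most $d-1$ columns at distinct positions) are linearly independent over $\mathbb{F}_q$ if and only if $$\left|\bigcup_{i\in S}A_i\right|\ge r|S|+1\quad\text{for every nonempty } S\subseteq[m]\text{ with }|S|\le t.$$
   Context: Write $[m]=\{1,\dots,m\}$ and $A_i=\{a_{i,1},\dots,a_{i,r+1}\}$ (distinct elements). Put $\mathbf{a}_{i,j}=(a_{i,j},a_{i,j}^2,\dots,a_{i,j}^{d-2})\in\mathbb{F}_q^{d-2}$, and let $\mathbf{e}_1,\dots,\mathbf{e}_m$ be the standard basis of $\mathbb{F}_q^m$. The matrix $H$ has one column $(\mathbf{e}_i,\mathbf{a}_{i,j})^T\in\mathbb{F}_q^{m+d-2}$ for each pair $(i,j)$ with $1\le i\le m$, $1\le j\le r+1$: $$H=\begin{pmatrix}\mathbf{e}_1^T&\cdots&\mathbf{e}_1^T&\cdots&\mathbf{e}_m^T&\cdots&\mathbf{e}_m^T\\ \mathbf{a}_{1,1}^T&\cdots&\mathbf{a}_{1,r+1}^T&\cdots&\mathbf{a}_{m,1}^T&\cdots&\mathbf{a}_{m,r+1}^T\end{pmatrix}.$$ *)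

theory Defs
  imports "Jordan_Normal_Form.VS_Connect"
begin

(* Indices are zero-based: the blocks 1..m and the positions 1..r+1 of the mathematical
   notation become {..<m} and {..<Suc r}; a i j is the j-th element of A i. *)

(* (a_ij, a_ij^2, ..., a_ij^(d-2)) for x = a_ij; vector indices start at 0, hence Suc k *)
definition power_vec :: "nat \<Rightarrow> 'a::field \<Rightarrow> 'a vec" where
  "power_vec d x = vec (d - 2) (\<lambda>k. x ^ Suc k)"

(* List.product varies j fastest, so the columns are grouped by i *)
definition vandermonde_H :: "nat \<Rightarrow> nat \<Rightarrow> nat \<Rightarrow> (nat \<Rightarrow> nat \<Rightarrow> 'a::field) \<Rightarrow> 'a mat" where
  "vandermonde_H d r m a =
     mat_of_cols (m + d - 2)
       (map (\<lambda>(i, j). unit_vec m i @\<^sub>v power_vec d (a i j))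
            (List.product [0..<m] [0..<Suc r]))"

(* Independence of the family of columns at the positions P: lin_dep speaks about sets of
   vectors, so equal columns at different positions are excluded by injectivity. *)
definition cols_lin_indpt :: "'a::field mat \<Rightarrow> nat set \<Rightarrow> bool" where
  "cols_lin_indpt H P \<longleftrightarrow>
     inj_on (col H) P \<and>
     \<not> module.lin_dep class_ring (module_vec TYPE('a) (dim_row H)) (col H ` P)"

end

(* View the columns as the edges of the bipartite graph joining block i to field element x when
   x is in A_i.  A linear relation among the columns weights the edges so that the weights at each
   block sum to 0; if at most d - 1 edges are involved, the power sums force (Vandermonde) the
   weights at each field element to sum to 0 as well.  So short relations are signed circulations,
   and they exist iff the graph has a cycle on at most t blocks, which is what the cardinality
   condition on unions excludes. *)

theory Submission
  imports Defs
begin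

section \<open>Column independence and relations\<close>

text \<open>Replaces independence of a set of vectors by triviality of relations indexed by column
  positions. Injectivity carries coefficients back and forth between positions and vectors.\<close>

lemma cols_lin_indpt_iff:
  fixes H :: "'a::field mat"
  assumes P: "P \<subseteq> {..<dim_col H}"
  shows "cols_lin_indpt H P \<longleftrightarrow>
    (\<forall>c. (\<forall>i<dim_row H. (\<Sum>p\<in>P. c p * H $$ (i, p)) = 0) \<longrightarrow> (\<forall>p\<in>P. c p = 0))"
    (is "_ \<longleftrightarrow> ?R")
proof -
  interpret vec_space "TYPE('a)" "dim_row H" .
  have fin: "finite P" using P finite_subset by blast
  have colc: "col H ` P \<subseteq> carrier_vec (dim_row H)" by auto
  have idx: "col H p $ i = H $$ (i, p)" if "p \<in> P" "i < dim_row H" for p i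
    using that P by auto
  show ?thesis
  proof
    assume "cols_lin_indpt H P"
    then have inj: "inj_on (col H) P" and ind: "\<not> lin_dep (col H ` P)"
      by (auto simp: cols_lin_indpt_def)
    show ?R
    proof (intro allI impI ballI, rule ccontr)
      fix c p assume c: "\<forall>i<dim_row H. (\<Sum>p\<in>P. c p * H $$ (i, p)) = 0"
        and p: "p \<in> P" "c p \<noteq> 0"
      define f where "f v = c (the_inv_into P (col H) v)" for v
      have f: "f (col H p) = c p" if "p \<in> P" for p
        using that inj by (simp add: f_def the_inv_into_f_f)
      have "lincomb f (col H ` P) = 0\<^sub>v (dim_row H)"
      proof (rule eq_vecI)
        fix i assume "i < dim_vec (0\<^sub>v (dim_row H) :: 'a vec)"
        then have i: "i < dim_row H" by simp
        have "lincomb f (col H ` P) $ i = (\<Sum>v\<in>col H ` P. f v * v $ i)"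
          by (rule lincomb_index[OF i colc])
        also have "\<dots> = (\<Sum>p\<in>P. c p * H $$ (i, p))"
          using inj i by (subst sum.reindex) (auto intro!: sum.cong simp: f idx simp del: index_col)
        finally show "lincomb f (col H ` P) $ i = 0\<^sub>v (dim_row H) $ i" using c i by simp
      next
        show "dim_vec (lincomb f (col H ` P)) = dim_vec (0\<^sub>v (dim_row H) :: 'a vec)"
          using lincomb_dim[of "col H ` P" f] fin colc by simp
      qed
      then have "lin_dep (col H ` P)"
        unfolding lin_dep_def
        using fin p f[OF p(1)]
        by (intro exI[of _ "col H ` P"] exI[of _ f] exI[of _ "col H p"]) (auto simp: class_ring_simps)
      then show False using ind by simp
    qed
  next
    assume R: ?R
    have inj: "inj_on (col H) P"
    proof (rule inj_onI, rule ccontr)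
      fix p p' assume pp: "p \<in> P" "p' \<in> P" "col H p = col H p'" "p \<noteq> p'"
      \<comment> \<open>Two equal columns at different positions cancel with weights 1 and
        -1.\<close>
      define c :: "nat \<Rightarrow> 'a" where "c s = (if s = p then 1 else if s = p' then - 1 else 0)" for s
      have "(\<Sum>s\<in>P. c s * H $$ (i, s)) = 0" if i: "i < dim_row H" for i
      proof -
        have "(\<Sum>s\<in>P. c s * H $$ (i, s)) = (\<Sum>s\<in>{p, p'}. c s * H $$ (i, s))"
          using fin pp by (intro sum.mono_neutral_right) (auto simp: c_def)
        also have "\<dots> = H $$ (i, p) - H $$ (i, p')" using pp(4) by (simp add: c_def)
        also have "\<dots> = 0" using idx[OF pp(1) i] idx[OF pp(2) i] pp(3) by simp
        finally show ?thesis .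
      qed
      then have "c p = 0" using R pp(1) by blast
      then show False by (simp add: c_def)
    qed
    moreover have "\<not> lin_dep (col H ` P)"
    proof
      assume "lin_dep (col H ` P)"
      then obtain A f v where A: "finite A" "A \<subseteq> col H ` P"
        and z: "lincomb f A = 0\<^sub>v (dim_row H)" and v: "v \<in> A" "f v \<noteq> 0"
        unfolding lin_dep_def by (auto simp: class_ring_simps)
      \<comment> \<open>The dependence may live on a proper subset \<open>A\<close> of the columns,
        so it is extended by 0 to all of \<open>P\<close>.\<close>
      define c where "c p = (if col H p \<in> A then f (col H p) else 0)" for p
      have "(\<Sum>p\<in>P. c p * H $$ (i, p)) = 0" if i: "i < dim_row H" for i
      proof -
        have "(\<Sum>p\<in>P. c p * H $$ (i, p)) =
            (\<Sum>u\<in>col H ` P. (if u \<in> A then f u else 0) * u $ i)"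
          using inj i by (subst sum.reindex) (auto intro!: sum.cong simp: c_def idx simp del: index_col)
        also have "\<dots> = (\<Sum>u\<in>A. f u * u $ i)"
          using A fin by (intro sum.mono_neutral_cong_right) auto
        also have "\<dots> = lincomb f A $ i"
          using lincomb_index[OF i, of A f] A colc by auto
        also have "\<dots> = 0" using z i by simp
        finally show ?thesis .
      qed
      then have "\<forall>p\<in>P. c p = 0" using R by blast
      then show False using v A by (auto simp: c_def split: if_splits)
    qed
    ultimately show "cols_lin_indpt H P" by (simp add: cols_lin_indpt_def)
  qed
qed

lemma vandermonde_H_dims:
  "dim_row (vandermonde_H d r m a) = m + d - 2"
  "dim_col (vandermonde_H d r m a) = m * Suc r"
  by (simp_all add: vandermonde_H_def)

text \<open>As \<open>j\<close> varies fastest in the product list, dividing \<open>p\<close> by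
  \<open>Suc r\<close> recovers the pair \<open>(i, j)\<close>. The bound on \<open>d\<close> makes
  the truncated \<open>m + d - 2\<close> equal to \<open>m + (d - 2)\<close>.\<close>

lemma vandermonde_H_index:
  assumes "2 \<le> d" "i < m + d - 2" "p < m * Suc r"
  shows "vandermonde_H d r m a $$ (i, p) =
    (if i < m then if p div Suc r = i then 1 else 0
     else a (p div Suc r) (p mod Suc r) ^ Suc (i - m))"
proof -
  have "p div Suc r < m" using assms(3) by (simp add: less_mult_imp_div_less)
  moreover have "p mod Suc r < Suc r" by simp
  moreover have "List.product [0..<m] [0..<Suc r] ! p = (p div Suc r, p mod Suc r)"
    using assms(3) calculation product_nth[of p "[0..<m]" "[0..<Suc r]"]
    by (simp del: upt_Suc mult_Suc_right)
  ultimately show ?thesis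
    using assms unfolding vandermonde_H_def
    by (subst mat_of_cols_index)
       (auto simp: power_vec_def unit_vec_def simp del: upt_Suc mult_Suc_right)
qed

section \<open>Circulations\<close>

text \<open>A family \<open>E\<close> is read as the edge set of a bipartite multigraph in which \<open>e\<close> joins \<open>b e\<close>
  to \<open>x e\<close>.\<close>

definition circulation ::
    "('e \<Rightarrow> 'b) \<Rightarrow> ('e \<Rightarrow> 'x) \<Rightarrow> 'e set \<Rightarrow> ('e \<Rightarrow> 'a::comm_monoid_add) \<Rightarrow> bool" where
  "circulation b x E c \<longleftrightarrow>
    (\<forall>v. (\<Sum>e | e \<in> E \<and> b e = v. c e) = 0) \<and> (\<forall>y. (\<Sum>e | e \<in> E \<and> x e = y. c e) = 0)"

text \<open>By linearity the moments kill every polynomial of degree below \<open>card X\<close>.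
  Testing against the product of the factors with roots in \<open>X - {y}\<close> isolates the term
  at \<open>y\<close>.\<close>

lemma vandermonde_sums_zero:
  fixes f :: "'a::field \<Rightarrow> 'a"
  assumes fin: "finite X" and z: "\<And>k. k < card X \<Longrightarrow> (\<Sum>x\<in>X. f x * x ^ k) = 0" and y: "y \<in> X"
  shows "f y = 0"
proof -
  define p where "p = (\<Prod>u\<in>X - {y}. [:- u, 1:])"
  have "degree p \<le> card (X - {y})"
    unfolding p_def using degree_prod_sum_le[of "X - {y}" "\<lambda>u. [:- u, 1:]"] fin by simp
  then have deg: "degree p < card X"
    using fin y by (metis card_Diff1_less le_less_trans)
  have "(\<Sum>x\<in>X. f x * poly p x) = (\<Sum>x\<in>X. \<Sum>k\<le>degree p. coeff p k * (f x * x ^ k))"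
    by (simp add: poly_altdef sum_distrib_left algebra_simps)
  also have "\<dots> = (\<Sum>k\<le>degree p. coeff p k * (\<Sum>x\<in>X. f x * x ^ k))"
    by (subst sum.swap) (simp add: sum_distrib_left)
  also have "\<dots> = 0" using deg z by (intro sum.neutral) auto
  finally have "(\<Sum>x\<in>X. f x * poly p x) = 0" .
  moreover have "(\<Sum>x\<in>X. f x * poly p x) = (\<Sum>x\<in>{y}. f x * poly p x)"
    using fin y by (intro sum.mono_neutral_right) (auto simp: p_def poly_prod)
  moreover have "poly p y \<noteq> 0" using fin by (simp add: p_def poly_prod)
  ultimately show ?thesis by simp
qed

text \<open>The vertex sums over the field elements satisfy all the moment equations of orders
  \<open>0, \<dots>, n - 1\<close> (order \<open>0\<close> comes from the block sums), so the Vandermonde determinant kills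
  them as long as there are at most \<open>n\<close> of them.\<close>

lemma circulation_iff_moments:
  fixes x :: "'e \<Rightarrow> 'a::field"
  assumes fin: "finite E" and n: "card E \<le> n"
  shows "circulation b x E c \<longleftrightarrow>
    (\<forall>v. (\<Sum>e | e \<in> E \<and> b e = v. c e) = 0) \<and> (\<forall>k<n. k \<noteq> 0 \<longrightarrow> (\<Sum>e\<in>E. c e * x e ^ k) = 0)"
    (is "_ \<longleftrightarrow> ?B \<and> ?M")
proof -
  have group: "(\<Sum>e\<in>E. c e * x e ^ k) = (\<Sum>y\<in>x ` E. (\<Sum>e | e \<in> E \<and> x e = y. c e) * y ^ k)" for k
    by (subst sum.image_gen[OF fin, of _ x]) (auto simp: sum_distrib_right intro!: sum.cong)
  show ?thesis
  proof
    assume "circulation b x E c"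
    then show "?B \<and> ?M" by (auto simp: circulation_def group)
  next
    assume BM: "?B \<and> ?M"
    have "(\<Sum>e | e \<in> E \<and> x e = y. c e) = 0" if y: "y \<in> x ` E" for y
    proof (rule vandermonde_sums_zero[OF _ _ y])
      fix k assume k: "k < card (x ` E)"
      have "(\<Sum>e\<in>E. c e * x e ^ k) = 0"
      proof (cases "k = 0")
        case True
        \<comment> \<open>The moment of order 0 is the total weight, which is the sum of the block
          sums.\<close>
        then have "(\<Sum>e\<in>E. c e * x e ^ k) = (\<Sum>v\<in>b ` E. \<Sum>e | e \<in> E \<and> b e = v. c e)"
          by (simp add: sum.image_gen[OF fin, of _ b])
        then show ?thesis using BM by simp
      next
        case False
        then show ?thesis using BM k card_image_le[OF fin, of x] n by simp
      qed
      then show "(\<Sum>y\<in>x ` E. (\<Sum>e | e \<in> E \<and> x e = y. c e) * y ^ k) = 0"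
        by (simp add: group)
    qed (use fin in simp)
    moreover have "(\<Sum>e | e \<in> E \<and> x e = y. c e) = 0" if "y \<notin> x ` E" for y
      using that by (intro sum.neutral) auto
    ultimately have "(\<Sum>e | e \<in> E \<and> x e = y. c e) = 0" for y by blast
    then show "circulation b x E c" using BM by (simp add: circulation_def)
  qed
qed

text \<open>Pigeonhole: the constraint at one vertex is implied by the others, so there are fewer
  constraints than edges.\<close>

lemma exists_nonzero_circulation:
  assumes fin: "finite E" and ne: "E \<noteq> {}" and card: "card (b ` E) + card (x ` E) \<le> card E"
  shows "\<exists>c :: 'e \<Rightarrow> 'a::{ring_1, finite}. circulation b x E c \<and> (\<exists>e\<in>E. c e \<noteq> 0)"
proof -
  obtain y0 where y0: "y0 \<in> x ` E" using ne by auto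
  let ?Y = "x ` E - {y0}"
  define \<Phi> where "\<Phi> c = ((\<lambda>v\<in>b ` E. \<Sum>e | e \<in> E \<and> b e = v. c e),
      (\<lambda>y\<in>?Y. \<Sum>e | e \<in> E \<and> x e = y. c e))" for c :: "'e \<Rightarrow> 'a"
  let ?T = "(b ` E \<rightarrow>\<^sub>E (UNIV :: 'a set)) \<times> (?Y \<rightarrow>\<^sub>E (UNIV :: 'a set))"
  have q: "1 < card (UNIV :: 'a set)"
  proof -
    have "card {0, 1 :: 'a} \<le> card (UNIV :: 'a set)" by (rule card_mono) auto
    then show ?thesis by simp
  qed
  have "\<Phi> ` (E \<rightarrow>\<^sub>E UNIV) \<subseteq> ?T"
    unfolding \<Phi>_def by (intro image_subsetI SigmaI) (simp_all add: restrict_PiE_iff del: restrict_apply)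
  moreover have finT: "finite ?T" using fin by (auto intro!: finite_PiE)
  ultimately have "card (\<Phi> ` (E \<rightarrow>\<^sub>E UNIV)) \<le> card ?T" by (intro card_mono)
  also have "\<dots> = card (UNIV :: 'a set) ^ (card (b ` E) + card ?Y)"
    using fin by (simp add: card_cartesian_product card_funcsetE power_add)
  also have "\<dots> < card (UNIV :: 'a set) ^ card E"
  proof (rule power_strict_increasing[OF _ q])
    have "card ?Y < card (x ` E)" using fin y0 by (intro card_Diff1_less) auto
    then show "card (b ` E) + card ?Y < card E" using card by simp
  qed
  also have "\<dots> = card (E \<rightarrow>\<^sub>E (UNIV :: 'a set))" using fin by (simp add: card_funcsetE)
  finally have "\<not> inj_on \<Phi> (E \<rightarrow>\<^sub>E UNIV)" by (rule pigeonhole)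
  then obtain f g where fg: "f \<in> E \<rightarrow>\<^sub>E UNIV" "g \<in> E \<rightarrow>\<^sub>E UNIV" "f \<noteq> g" "\<Phi> f = \<Phi> g"
    by (auto simp: inj_on_def)
  \<comment> \<open>Vertex sums are additive, so a collision of \<open>\<Phi>\<close> gives a
    difference on which all recorded sums vanish.\<close>
  define c where "c e = f e - g e" for e
  have B: "(\<Sum>e | e \<in> E \<and> b e = v. c e) = 0" for v
  proof (cases "v \<in> b ` E")
    case True
    have "fst (\<Phi> f) v = fst (\<Phi> g) v" using fg(4) by simp
    then show ?thesis using True by (simp add: \<Phi>_def c_def sum_subtractf)
  qed (auto intro: sum.neutral)
  have X: "(\<Sum>e | e \<in> E \<and> x e = y. c e) = 0" if "y \<noteq> y0" for y
  proof (cases "y \<in> x ` E")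
    case True
    have "snd (\<Phi> f) y = snd (\<Phi> g) y" using fg(4) by simp
    then show ?thesis using True that by (simp add: \<Phi>_def c_def sum_subtractf)
  qed (auto intro: sum.neutral)
  \<comment> \<open>Both sides equal the total weight of \<open>E\<close>; this recovers the one
    omitted constraint, at \<open>y0\<close>.\<close>
  have "(\<Sum>y\<in>x ` E. \<Sum>e | e \<in> E \<and> x e = y. c e) = (\<Sum>v\<in>b ` E. \<Sum>e | e \<in> E \<and> b e = v. c e)"
    by (simp flip: sum.image_gen[OF fin])
  also have "\<dots> = 0" using B by simp
  finally have "(\<Sum>e | e \<in> E \<and> x e = y0. c e) = 0"
    using X fin y0 by (simp add: sum.remove[of "x ` E" y0])
  then have "(\<Sum>e | e \<in> E \<and> x e = y. c e) = 0" for y using X by (cases "y = y0") auto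
  then have "circulation b x E c" using B by (simp add: circulation_def)
  moreover have "\<exists>e\<in>E. c e \<noteq> 0"
    using PiE_ext[OF fg(1,2)] fg(3) by (auto simp: c_def)
  ultimately show ?thesis by blast
qed

section \<open>Edge sets without leaves\<close>

text \<open>Every nonempty fibre of \<open>f\<close> has at least two members, and the fibres
  partition \<open>E\<close>.\<close>

lemma card_image_le_half:
  assumes fin: "finite E" and two: "\<And>e. e \<in> E \<Longrightarrow> \<exists>e'\<in>E. e' \<noteq> e \<and> f e' = f e"
  shows "2 * card (f ` E) \<le> card E"
proof -
  have "2 * card (f ` E) = (\<Sum>v\<in>f ` E. 2)" by simp
  also have "\<dots> \<le> (\<Sum>v\<in>f ` E. card {e \<in> E. f e = v})"
  proof (rule sum_mono)
    fix v assume "v \<in> f ` E"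
    then obtain e where e: "e \<in> E" "f e = v" by auto
    then obtain e' where "e' \<in> E" "e' \<noteq> e" "f e' = v" using two by metis
    then have "{e, e'} \<subseteq> {e \<in> E. f e = v}" and "card {e, e'} = 2" using e by auto
    then show "2 \<le> card {e \<in> E. f e = v}"
      using card_mono[of "{e \<in> E. f e = v}" "{e, e'}"] fin by simp
  qed
  also have "\<dots> = card E"
    using sum.image_gen[OF fin, of "\<lambda>_. 1::nat" f] by simp
  finally show ?thesis .
qed

text \<open>A single nonzero weight cannot sum to 0. Used for blocks and for elements, this shows
  that the support of a circulation has no leaves.\<close>

lemma zero_fibre_sum_no_leaf:
  fixes c :: "'e \<Rightarrow> 'a::comm_monoid_add"
  assumes "finite P" "(\<Sum>e' | e' \<in> P \<and> f e' = f e. c e') = 0" "e \<in> P" "c e \<noteq> 0"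
  shows "\<exists>e'\<in>P. c e' \<noteq> 0 \<and> e' \<noteq> e \<and> f e' = f e"
proof (rule ccontr)
  assume "\<not> ?thesis"
  then have "(\<Sum>e' | e' \<in> P \<and> f e' = f e. c e') = (\<Sum>e'\<in>{e}. c e')"
    using assms(1,3) by (intro sum.mono_neutral_right) auto
  then show False using assms(2,4) by simp
qed

text \<open>A connected edge set is exhausted by adding blocks one at a time, each meeting the union of
  the earlier ones and hence contributing at most \<open>r\<close> new elements; the last block, having two
  edges whose elements are shared with other blocks, contributes at most \<open>r - 1\<close>.\<close>

lemma no_leaf_imp_small_union:
  assumes "finite E" "E \<noteq> {}"
    and "inj_on (\<lambda>e. (b e, x e)) E"
    and "\<And>e. e \<in> E \<Longrightarrow> x e \<in> N (b e) \<and> finite (N (b e)) \<and> card (N (b e)) = Suc r"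
    and "\<And>e. e \<in> E \<Longrightarrow> \<exists>e'\<in>E. e' \<noteq> e \<and> b e' = b e"
    and "\<And>e. e \<in> E \<Longrightarrow> \<exists>e'\<in>E. e' \<noteq> e \<and> x e' = x e"
  shows "\<exists>S\<subseteq>b ` E. S \<noteq> {} \<and> card (\<Union>v\<in>S. N v) \<le> r * card S"
  using assms
proof (induction E rule: finite_psubset_induct)
  case (psubset E)
  note inj = psubset.prems(2) and N = psubset.prems(3) and twob = psubset.prems(4)
    and twox = psubset.prems(5)
  show ?case
  \<comment> \<open>Such a \<open>T\<close> is the block set of a proper union of connected
    components. The edges at \<open>T\<close> then keep all their partners, so the induction
    hypothesis applies to them.\<close>
  proof (cases "\<exists>T. T \<subset> b ` E \<and> T \<noteq> {} \<and> (\<forall>e\<in>E. \<forall>e'\<in>E. x e = x e' \<and> b e' \<in> T \<longrightarrow> b e \<in> T)")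
    case True
    then obtain T where T: "T \<subset> b ` E" "T \<noteq> {}"
      and closed: "\<And>e e'. e \<in> E \<Longrightarrow> e' \<in> E \<Longrightarrow> x e = x e' \<Longrightarrow> b e' \<in> T \<Longrightarrow> b e \<in> T" by blast
    define F where "F = {e \<in> E. b e \<in> T}"
    have FE: "F \<subset> E" using T by (auto simp: F_def)
    have "\<exists>S\<subseteq>b ` F. S \<noteq> {} \<and> card (\<Union>v\<in>S. N v) \<le> r * card S"
    proof (rule psubset.IH[OF FE])
      show "F \<noteq> {}" using T by (auto simp: F_def)
      show "inj_on (\<lambda>e. (b e, x e)) F" using inj FE by (auto intro: inj_on_subset)
      show "x e \<in> N (b e) \<and> finite (N (b e)) \<and> card (N (b e)) = Suc r" if "e \<in> F" for e
        using that N by (simp add: F_def)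
      show "\<exists>e'\<in>F. e' \<noteq> e \<and> b e' = b e" if "e \<in> F" for e
        using that twob[of e] by (auto simp: F_def)
      show "\<exists>e'\<in>F. e' \<noteq> e \<and> x e' = x e" if e: "e \<in> F" for e
      proof -
        obtain e' where e': "e' \<in> E" "e' \<noteq> e" "x e' = x e" using twox[of e] e FE by blast
        then have "e' \<in> F" using closed[of e' e] e by (simp add: F_def)
        then show ?thesis using e' by blast
      qed
    qed
    then obtain S where S: "S \<subseteq> b ` F" "S \<noteq> {} \<and> card (\<Union>v\<in>S. N v) \<le> r * card S" by blast
    have "S \<subseteq> b ` E" using S(1) FE by blast
    with S(2) show ?thesis by (intro exI[of _ S] conjI) simp_all
  next
    case False
    \<comment> \<open>The bound allows \<open>r\<close> elements per block and one extra for the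
      starting block. Requiring \<open>T\<close> to be proper stops the growth just before the last
      block.\<close>
    define good where "good T \<longleftrightarrow> T \<subset> b ` E \<and> T \<noteq> {} \<and> card (\<Union>v\<in>T. N v) \<le> r * card T + 1" for T
    obtain e0 where e0: "e0 \<in> E" using psubset.prems(1) by auto
    obtain e1 where e1: "e1 \<in> E" "e1 \<noteq> e0" "x e1 = x e0" using twox[OF e0] by blast
    have "b e1 \<noteq> b e0" using inj e0 e1 by (auto simp: inj_on_def)
    then have "good {b e0}" using e0 e1 N[OF e0] by (auto simp: good_def)
    moreover have "good T \<Longrightarrow> card T \<le> card (b ` E)" for T
      using psubset.hyps by (auto simp: good_def intro: card_mono)
    ultimately have "\<exists>T. good T \<and> (\<forall>T'. good T' \<longrightarrow> card T' \<le> card T)"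
      by (intro ex_has_greatest_nat[where b = "Suc (card (b ` E))"]) (auto simp: less_Suc_eq_le)
    then obtain T where T: "good T" and max: "\<And>T'. good T' \<Longrightarrow> card T' \<le> card T" by blast
    have TE: "T \<subset> b ` E" and T0: "T \<noteq> {}" and Tc: "card (\<Union>v\<in>T. N v) \<le> r * card T + 1"
      using T by (auto simp: good_def)
    have finT: "finite T" using TE psubset.hyps by (meson finite_imageI finite_subset psubset_imp_subset)
    let ?U = "\<Union>v\<in>T. N v"
    have finU: "finite ?U" using finT TE N by auto
    \<comment> \<open>Since \<open>T\<close> is not closed under sharing elements, some block
      outside it meets its union.\<close>
    obtain e e' where e: "e \<in> E" "e' \<in> E" "x e = x e'" "b e' \<in> T" "b e \<notin> T"
      using False TE T0 by blast
    let ?w = "b e"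
    have cardins: "card (insert ?w T) = Suc (card T)" using e finT by simp
    have Ne: "finite (N ?w)" "card (N ?w) = Suc r" using N[OF e(1)] by auto
    have union: "card (\<Union>v\<in>insert ?w T. N v) + card (N ?w \<inter> ?U) = Suc r + card ?U"
      using card_Un_Int[OF Ne(1) finU] Ne(2) by simp
    have shared: "x f \<in> N ?w \<inter> ?U" if "f \<in> E" "b f = ?w" "f' \<in> E" "x f' = x f" "b f' \<in> T" for f f'
      using that N[of f] N[of f'] by auto
    have "0 < card (N ?w \<inter> ?U)"
      using shared[OF e(1) refl e(2) e(3)[symmetric] e(4)] Ne by (auto simp: card_gt_0_iff)
    then have "card (\<Union>v\<in>insert ?w T. N v) \<le> r * card (insert ?w T) + 1"
      using union Tc cardins by simp
    \<comment> \<open>The enlarged set satisfies the cardinality bound, so by maximality of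
      \<open>T\<close> it can only fail to be good by not being proper.\<close>
    then have all: "insert ?w T = b ` E"
      using max[of "insert ?w T"] cardins TE e by (auto simp: good_def)
    obtain f where f: "f \<in> E" "f \<noteq> e" "b f = ?w" using twob[OF e(1)] by blast
    have xs: "x g \<in> N ?w \<inter> ?U" if g: "g \<in> E" "b g = ?w" for g
    proof -
      obtain g' where g': "g' \<in> E" "g' \<noteq> g" "x g' = x g" using twox[OF g(1)] by blast
      then have "b g' \<noteq> ?w" using inj g by (auto simp: inj_on_def)
      then have "b g' \<in> T" using all g'(1) by blast
      then show ?thesis using shared g g' by blast
    qed
    have "x f \<noteq> x e" using inj e(1) f by (auto simp: inj_on_def)
    \<comment> \<open>Two shared elements at the last block save one more than the usual overlap,
      which removes the extra 1 from the bound.\<close>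
    then have "2 = card {x e, x f}" by auto
    also have "\<dots> \<le> card (N ?w \<inter> ?U)" using xs[OF e(1) refl] xs[OF f(1,3)] Ne by (intro card_mono) auto
    finally have "card (\<Union>v\<in>insert ?w T. N v) \<le> r * card (insert ?w T)"
      using union Tc cardins by simp
    then show ?thesis using all by (intro exI[of _ "insert ?w T"]) auto
  qed
qed

text \<open>In a minimal edge set with at least as many edges as vertices there are no leaves among the
  elements, so the elements number at most half of the edges and the blocks at least half.\<close>

lemma exists_few_edges:
  assumes "finite E" "E \<noteq> {}" "card (b ` E) + card (x ` E) \<le> card E"
  shows "\<exists>F\<subseteq>E. F \<noteq> {} \<and> card (b ` F) + card (x ` F) \<le> card F \<and> card F \<le> 2 * card (b ` F)"
  using assms
proof (induction E rule: finite_psubset_induct)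
  case (psubset E)
  show ?case
  proof (cases "\<exists>F\<subset>E. F \<noteq> {} \<and> card (b ` F) + card (x ` F) \<le> card F")
    case True
    then obtain F where F: "F \<subset> E" "F \<noteq> {}" "card (b ` F) + card (x ` F) \<le> card F" by blast
    from psubset.IH[OF this] F(1) show ?thesis by (meson order_trans psubset_imp_subset)
  next
    case False
    \<comment> \<open>By minimality the smaller edge set has at least \<open>card E\<close>
      vertices, while \<open>E\<close> itself has at most \<open>card E\<close>. Hence deleting an
      edge loses no vertex and equality holds.\<close>
    have del: "x ` (E - {e}) = x ` E \<and> card E = card (b ` E) + card (x ` E)" if e: "e \<in> E" for e
    proof -
      have "E \<noteq> {e}" using psubset.prems by auto
      then have "card (E - {e}) < card (b ` (E - {e})) + card (x ` (E - {e}))"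
      proof -
        have "E - {e} \<subset> E" "E - {e} \<noteq> {}" using e \<open>E \<noteq> {e}\<close> by auto
        then show ?thesis using False not_le by blast
      qed
      moreover have "card (E - {e}) = card E - 1" using e by simp
      moreover have "card (b ` (E - {e})) \<le> card (b ` E)" "card (x ` (E - {e})) \<le> card (x ` E)"
        using psubset.hyps by (auto intro!: card_mono)
      ultimately have "card (x ` (E - {e})) = card (x ` E)" "card E = card (b ` E) + card (x ` E)"
        using psubset.prems by linarith+
      then show ?thesis
        using psubset.hyps by (metis Diff_subset card_subset_eq finite_imageI image_mono)
    qed
    have "2 * card (x ` E) \<le> card E"
    proof (rule card_image_le_half[OF psubset.hyps])
      fix e assume e: "e \<in> E"
      then have "x e \<in> x ` (E - {e})" using del by blast
      then show "\<exists>e'\<in>E. e' \<noteq> e \<and> x e' = x e" by auto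
    qed
    moreover have "card E = card (b ` E) + card (x ` E)" using del psubset.prems(1) by blast
    ultimately show ?thesis using psubset.prems by (intro exI[of _ E]) auto
  qed
qed

section \<open>The columns of \<open>H\<close> as edges\<close>

theorem theorem3p1:
  fixes q d r m t :: nat
    and A :: "nat \<Rightarrow> 'a::{field,finite} set"
    and a :: "nat \<Rightarrow> nat \<Rightarrow> 'a"
    and H :: "'a mat"
  assumes "card (UNIV :: 'a set) = q"
    and "d \<ge> 5" and "r \<ge> 1" and "m \<ge> 1"
    and "\<And>i. i < m \<Longrightarrow> card (A i) = r + 1"
    and "\<And>i. i < m \<Longrightarrow> bij_betw (a i) {..<Suc r} (A i)"
  defines "H \<equiv> vandermonde_H d r m a"
    and "t \<equiv> (d - 1) div 2"
  shows "(\<forall>P. P \<subseteq> {..<dim_col H} \<and> card P \<le> d - 1 \<longrightarrow> cols_lin_indpt H P) \<longleftrightarrow>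
         (\<forall>S. S \<subseteq> {..<m} \<and> S \<noteq> {} \<and> card S \<le> t \<longrightarrow> card (\<Union>i\<in>S. A i) \<ge> r * card S + 1)"
proof -
  define b where "b p = p div Suc r" for p
  define x where "x p = a (p div Suc r) (p mod Suc r)" for p
  have dims: "dim_row H = m + d - 2" "dim_col H = m * Suc r"
    by (simp_all only: H_def vandermonde_H_dims)
  have b: "b p < m" if "p < m * Suc r" for p
    using that by (simp add: b_def less_mult_imp_div_less)
  have xA: "x p \<in> A (b p)" if "p < m * Suc r" for p
    using b[OF that] assms(6)[of "b p"] by (auto simp: x_def b_def bij_betw_def)
  have inj: "inj_on (\<lambda>p. (b p, x p)) {..<m * Suc r}"
  proof (rule inj_onI)
    fix p p' assume p: "p \<in> {..<m * Suc r}" "p' \<in> {..<m * Suc r}" and "(b p, x p) = (b p', x p')"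
    then have *: "p div Suc r = p' div Suc r" "a (p div Suc r) (p mod Suc r) = a (p div Suc r) (p' mod Suc r)"
      by (auto simp: b_def x_def)
    have "inj_on (a (p div Suc r)) {..<Suc r}"
      using assms(6) b[of p] p by (auto simp: b_def bij_betw_def)
    from inj_onD[OF this *(2)] have "p mod Suc r = p' mod Suc r" by simp
    then show "p = p'" using *(1) by (metis div_mult_mod_eq)
  qed
  have indpt: "cols_lin_indpt H P \<longleftrightarrow> (\<forall>c :: nat \<Rightarrow> 'a. circulation b x P c \<longrightarrow> (\<forall>p\<in>P. c p = 0))"
    if P: "P \<subseteq> {..<dim_col H}" "card P \<le> d - 1" for P
  proof -
    have fin: "finite P" using P(1) finite_subset by blast
    have Pm: "p < m * Suc r" if "p \<in> P" for p using that P(1) dims by auto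
    have "(\<forall>i<dim_row H. (\<Sum>p\<in>P. c p * H $$ (i, p)) = 0) \<longleftrightarrow> circulation b x P c"
      for c :: "nat \<Rightarrow> 'a"
    proof -
      have top: "(\<Sum>p\<in>P. c p * H $$ (i, p)) = (\<Sum>p | p \<in> P \<and> b p = i. c p)" if "i < m" for i
        using that fin Pm assms(2) unfolding H_def
        by (subst sum.inter_filter)
           (auto intro!: sum.cong simp: vandermonde_H_index b_def simp del: mult_Suc_right)
      have bot: "(\<Sum>p\<in>P. c p * H $$ (i, p)) = (\<Sum>p\<in>P. c p * x p ^ Suc (i - m))"
        if "m \<le> i" "i < m + d - 2" for i
        using that fin Pm assms(2) unfolding H_def
        by (auto intro!: sum.cong simp: vandermonde_H_index x_def simp del: mult_Suc_right)
      have out: "(\<Sum>p | p \<in> P \<and> b p = v. c p) = 0" if "\<not> v < m" for v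
        using that b Pm by (intro sum.neutral) auto
      have "(\<forall>i<dim_row H. (\<Sum>p\<in>P. c p * H $$ (i, p)) = 0) \<longleftrightarrow>
          (\<forall>v. (\<Sum>p | p \<in> P \<and> b p = v. c p) = 0) \<and> (\<forall>k<d-1. k \<noteq> 0 \<longrightarrow> (\<Sum>p\<in>P. c p * x p ^ k) = 0)"
        (is "?L \<longleftrightarrow> ?R")
      proof
        assume L: ?L
        have "(\<Sum>p\<in>P. c p * x p ^ k) = 0" if "k < d - 1" "k \<noteq> 0" for k
          using L[rule_format, of "m + (k - 1)"] bot[of "m + (k - 1)"] that dims by simp
        moreover have "(\<Sum>p | p \<in> P \<and> b p = v. c p) = 0" for v
          using L[rule_format, of v] top[of v] out[of v] dims assms(2) by (cases "v < m") auto
        ultimately show ?R by blast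
      next
        assume R: ?R
        show ?L
        proof (intro allI impI)
          fix i assume i: "i < dim_row H"
          show "(\<Sum>p\<in>P. c p * H $$ (i, p)) = 0"
          proof (cases "i < m")
            case True then show ?thesis using R top by simp
          next
            case False
            then have "Suc (i - m) < d - 1" using i dims assms(2) by simp
            then show ?thesis using R bot[of i] False i dims by (metis not_less nat.distinct(1))
          qed
        qed
      qed
      then show ?thesis by (simp only: circulation_iff_moments[OF fin P(2)])
    qed
    then show ?thesis using cols_lin_indpt_iff[OF P(1)] by simp
  qed
  show ?thesis
  proof (intro iffI allI impI)
    fix P assume S: "\<forall>S. S \<subseteq> {..<m} \<and> S \<noteq> {} \<and> card S \<le> t \<longrightarrow> card (\<Union>i\<in>S. A i) \<ge> r * card S + 1"
      and P: "P \<subseteq> {..<dim_col H} \<and> card P \<le> d - 1"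
    have fin: "finite P" using P finite_subset by blast
    have "c p = 0" if c: "circulation b x P c" and p: "p \<in> P" for c :: "nat \<Rightarrow> 'a" and p
    proof (rule ccontr)
      assume cp: "c p \<noteq> 0"
      \<comment> \<open>Leaves are excluded only on the support, so edges of weight 0 are
        discarded.\<close>
      define E where "E = {e \<in> P. c e \<noteq> 0}"
      have E: "finite E" "E \<noteq> {}" "E \<subseteq> {..<m * Suc r}" "card E \<le> d - 1"
        using fin p cp P dims card_mono[OF fin, of E] by (auto simp: E_def)
      have twob: "\<exists>e'\<in>E. e' \<noteq> e \<and> b e' = b e" and twox: "\<exists>e'\<in>E. e' \<noteq> e \<and> x e' = x e" if "e \<in> E" for e
        using zero_fibre_sum_no_leaf[where P=P and c=c and e=e and f=b]
          zero_fibre_sum_no_leaf[where P=P and c=c and e=e and f=x] that fin c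
        by (auto simp: E_def circulation_def)
      have "\<exists>S\<subseteq>b ` E. S \<noteq> {} \<and> card (\<Union>v\<in>S. A v) \<le> r * card S"
      proof (rule no_leaf_imp_small_union[OF E(1,2) _ _ twob twox])
        show "inj_on (\<lambda>e. (b e, x e)) E" using inj E(3) by (rule inj_on_subset)
        show "x e \<in> A (b e) \<and> finite (A (b e)) \<and> card (A (b e)) = Suc r" if "e \<in> E" for e
          using that E(3) xA[of e] b[of e] assms(5)[of "b e"] by auto
      qed
      then obtain S' where S': "S' \<subseteq> b ` E" "S' \<noteq> {}" "card (\<Union>v\<in>S'. A v) \<le> r * card S'" by blast
      have "card S' \<le> card (b ` E)" using S'(1) E(1) by (intro card_mono) auto
      \<comment> \<open>Each block carries at least two edges of the support, which is where the
        halving in \<open>t\<close> comes from.\<close>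
      moreover have "2 * card (b ` E) \<le> d - 1"
        using card_image_le_half[OF E(1) twob] E(4) by simp
      ultimately have "card S' \<le> t" by (simp add: t_def)
      moreover have "S' \<subseteq> {..<m}" using S'(1) E(3) b by auto
      ultimately have "r * card S' + 1 \<le> card (\<Union>v\<in>S'. A v)" using S S'(2) by blast
      then show False using S'(3) by simp
    qed
    then show "cols_lin_indpt H P" using indpt P by blast
  next
    fix S assume L: "\<forall>P. P \<subseteq> {..<dim_col H} \<and> card P \<le> d - 1 \<longrightarrow> cols_lin_indpt H P"
      and S: "S \<subseteq> {..<m} \<and> S \<noteq> {} \<and> card S \<le> t"
    have finS: "finite S" using S finite_subset by blast
    show "r * card S + 1 \<le> card (\<Union>i\<in>S. A i)"
    proof (rule ccontr)
      assume "\<not> ?thesis"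
      then have small: "card (\<Union>i\<in>S. A i) \<le> r * card S" by simp
      \<comment> \<open>All edges at the blocks of \<open>S\<close>: there are
        \<open>card S * Suc r\<close> of them, at least \<open>card S\<close> plus the size of the
        small union.\<close>
      define E where "E = (\<lambda>(i, j). i * Suc r + j) ` (S \<times> {..<Suc r})"
      have bE: "b (i * Suc r + j) = i" if "j < Suc r" for i j
        using that by (simp add: b_def del: mult_Suc_right)
      have Em: "E \<subseteq> {..<m * Suc r}"
      proof
        fix p assume "p \<in> E"
        then obtain i j where ij: "i \<in> S" "j < Suc r" "p = i * Suc r + j" by (auto simp: E_def)
        then have "Suc i \<le> m" using S by auto
        then have "Suc i * Suc r \<le> m * Suc r" by (rule mult_le_mono1)
        then show "p \<in> {..<m * Suc r}" using ij by simp
      qed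
      have "inj_on (\<lambda>(i, j). i * Suc r + j) (S \<times> {..<Suc r})"
        using bE by (auto simp: inj_on_def simp del: mult_Suc_right) (metis add_left_cancel)+
      then have cardE: "card E = card S * Suc r"
        unfolding E_def by (subst card_image) (auto simp: card_cartesian_product)
      have bS: "b ` E \<subseteq> S" by (auto simp: E_def bE simp del: mult_Suc_right)
      have "x ` E \<subseteq> (\<Union>i\<in>S. A i)" using bS xA Em by blast
      then have "card (x ` E) \<le> card (\<Union>i\<in>S. A i)" by (intro card_mono) auto
      moreover have "card (b ` E) \<le> card S" by (rule card_mono[OF finS bS])
      ultimately have "card (b ` E) + card (x ` E) \<le> card E" using small cardE by (simp add: mult.commute)
      moreover have "finite E" "E \<noteq> {}" using finS S by (auto simp: E_def)
      \<comment> \<open>\<open>E\<close> may exceed \<open>d - 1\<close> columns. The subset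
        \<open>F\<close> has at most \<open>2 * t\<close> edges and still enough to carry a nonzero
        circulation.\<close>
      ultimately obtain F where F: "F \<subseteq> E" "F \<noteq> {}" "card (b ` F) + card (x ` F) \<le> card F"
          "card F \<le> 2 * card (b ` F)"
        using exists_few_edges[of E b x] by blast
      have finF: "finite F" using F(1) \<open>finite E\<close> finite_subset by blast
      obtain c :: "nat \<Rightarrow> 'a" where c: "circulation b x F c" "\<exists>e\<in>F. c e \<noteq> 0"
        using exists_nonzero_circulation[OF finF F(2,3)] by blast
      have "card (b ` F) \<le> card S" using F(1) bS finS by (intro card_mono) auto
      then have "card F \<le> 2 * t" using F(4) S by linarith
      then have "card F \<le> d - 1" by (simp add: t_def)
      moreover have "F \<subseteq> {..<dim_col H}" using F(1) Em dims by auto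
      ultimately show False using L indpt[of F] c by blast
    qed
  qed
qed

end
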